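(* Let $a,b\in\mathbb{N}$ with $a<b$. Then there exists an $n\in\mathbb{N}$ such that $R^n\left(\tfrac{a}{b}\right)\in\{0,1\}$, where $R$ is the Romik map.
   Context: $\mathbb{N}=\{1,2,3,\dots\}$. The Romik map $R:[0,1]\to[0,1]$ is defined by $R(x)=\frac{x}{1-2x}$ for $0\le x\le \frac13$, $R(x)=\frac1x-2$ for $\frac13\le x\le\frac12$, and $R(x)=2-\frac1x$ for $\frac12\le x\le 1$ (the formulas agree at the common endpoints). $R^n$ denotes the $n$-fold iterate of $R$. *)

theory Defs
  imports Complex_Main
begin

(* The Romik map is a self-map of [0,1]. As a total function on the reals it is
   meaningful on [0,1] only; the values outside [0,1] are irrelevant, since
   romik_in_unit shows that orbits starting in [0,1] stay there. *)
definition romik :: "real \<Rightarrow> real" where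
  "romik x = (if x \<le> 1/3 then x / (1 - 2 * x)
              else if x \<le> 1/2 then 1 / x - 2
              else 2 - 1 / x)"

lemma romik_left: "0 \<le> x \<Longrightarrow> x \<le> 1/3 \<Longrightarrow> romik x = x / (1 - 2 * x)"
  by (simp add: romik_def)

lemma romik_middle:
  assumes "1/3 \<le> x" "x \<le> 1/2"
  shows "romik x = 1 / x - 2"
proof (cases "x = 1/3")
  case True
  show ?thesis unfolding True by (simp add: romik_def)
next
  case False
  then show ?thesis using assms by (simp add: romik_def)
qed

lemma romik_right:
  assumes "1/2 \<le> x" "x \<le> 1"
  shows "romik x = 2 - 1 / x"
proof (cases "x = 1/2")
  case True
  show ?thesis unfolding True by (simp add: romik_def)
next
  case False
  then show ?thesis using assms by (simp add: romik_def)
qed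

lemma romik_in_unit:
  assumes "x \<in> {0..1}"
  shows "romik x \<in> {0..1}"
  using assms by (auto simp: romik_def field_simps)

end

theory Submission
  imports Defs
begin

text \<open>
  On each of its three branches the Romik map sends a fraction \<open>a / b\<close> with \<open>0 < a < b\<close> to a
  fraction in the unit interval whose denominator is \<open>b - 2 * a\<close> or \<open>a\<close>, hence smaller than \<open>b\<close>
  (lemma \<open>romik_fraction\<close>). By descent on the denominator the orbit of a rational number cannot
  stay in the open interval for ever, so it reaches \<open>0\<close> or \<open>1\<close>.
\<close>

text \<open>The fraction \<open>c / d\<close> need not be in lowest terms.\<close>

lemma romik_fraction:
  fixes a b :: nat
  assumes "0 < a" "a < b"
  obtains c d where "c \<le> d" "0 < d" "d < b" "romik (real a / real b) = real c / real d"
proof -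
  consider (left) "3 * a \<le> b" | (middle) "b < 3 * a" "2 * a \<le> b" | (right) "b < 2 * a"
    by linarith
  then show thesis
  proof cases
    case left
    have "romik (real a / real b) = (real a / real b) / (1 - 2 * (real a / real b))"
      using assms left by (intro romik_left) (simp_all add: field_simps)
    also have "\<dots> = real a / real (b - 2 * a)"
      using assms left by (simp add: of_nat_diff field_simps)
    finally show thesis
      using assms left by (intro that[of a "b - 2 * a"]) simp_all
  next
    case middle
    have "romik (real a / real b) = 1 / (real a / real b) - 2"
      using assms middle by (intro romik_middle) (simp_all add: field_simps)
    also have "\<dots> = real (b - 2 * a) / real a"
      using assms middle by (simp add: of_nat_diff field_simps)
    finally show thesis
      using assms middle by (intro that[of "b - 2 * a" a]) simp_all
  next
    case right
    have "romik (real a / real b) = 2 - 1 / (real a / real b)"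
      using assms right by (intro romik_right) (simp_all add: field_simps)
    also have "\<dots> = real (2 * a - b) / real a"
      using assms right by (simp add: of_nat_diff field_simps)
    finally show thesis
      using assms right by (intro that[of "2 * a - b" a]) simp_all
  qed
qed

theorem proposition2p1:
  fixes a b :: nat
  assumes "1 \<le> a" and "1 \<le> b" and "a < b"
  shows "\<exists>n::nat. 1 \<le> n \<and> (romik ^^ n) (real a / real b) \<in> {0, 1}"
  using assms
proof (induction b arbitrary: a rule: less_induct)
  case (less b)
  obtain c d where cd: "c \<le> d" "0 < d" "d < b"
    and step: "romik (real a / real b) = real c / real d"
    using less.prems by (auto intro: romik_fraction[of a b])
  show ?case
  proof (cases "c = 0 \<or> c = d")
    case True
    then have "(romik ^^ 1) (real a / real b) \<in> {0, 1}"
      using step cd by auto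
    then show ?thesis by blast
  next
    case False
    then obtain n where "(romik ^^ n) (real c / real d) \<in> {0, 1}"
      using less.IH[of d c] cd by auto
    then have "(romik ^^ Suc n) (real a / real b) \<in> {0, 1}"
      by (simp add: funpow_swap1 step del: funpow.simps add: funpow_Suc_right)
    then show ?thesis by (metis le_add1 plus_1_eq_Suc)
  qed
qed

end
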